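(* For $p\in\mathbb{N}_0$ and all $n\in\mathbb{N}$, $$\sum_{m=1}^nm^pH_{m-1}^2=C^{(p)}(n)H_n^2-\big(2C^{(p)}_0(n)+B_p\big)H_n+2C^{(p)}_{0,0}(n)-C^{(p)}_1(n).$$
   Context: $H_m=\sum_{j=1}^m1/j$ is the $m$-th harmonic number ($H_0=0$). Bernoulli numbers: $\frac{te^t}{e^t-1}=\sum_{j\ge0}B_j\frac{t^j}{j!}$ (so $B_1=1/2$). For $p\in\mathbb{N}_0$, $r\ge1$, $a_2,\dots,a_r\in\mathbb{N}_0$ and $a_1=0$, $$C^{(p)}_{a_2,\dots,a_r}(x)=\sum_{\substack{j_1,\dots,j_r\ge0\\ j_1+\dots+j_r\le p-a_r}}\Big(\prod_{i=1}^r\frac{\binom{p+1-a_i-j_1-\dots-j_{i-1}}{j_i}B_{j_i}}{p+1-a_i-j_1-\dots-j_{i-1}}\Big)x^{p+1-a_r-j_1-\dots-j_r}$$ (empty sum $=0$). For $r=1$ (no subscript), $C^{(p)}(x)=\sum_{j=0}^p\binom{p+1}{j}\frac{B_j}{p+1}x^{p+1-j}$, so $C^{(p)}(n)=\sum_{m=1}^nm^p$. *)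

theory Defs
  imports
    "HOL-Analysis.Analysis"
    "HOL-Computational_Algebra.Formal_Power_Series"
begin

(* Bernoulli numbers with B_1 = 1/2: the exponential generating function is t e^t / (e^t - 1).
   Numerator and denominator both have subdegree 1, so the fps quotient is the exact one
   (lemma bernoulli_egf below). *)
definition bernoulli :: "nat \<Rightarrow> real" where
  "bernoulli j = fact j * fps_nth (fps_X * fps_exp 1 / (fps_exp 1 - 1)) j"

lemma bernoulli_egf:
  "Abs_fps (\<lambda>j. bernoulli j / fact j) * (fps_exp 1 - 1) = fps_X * fps_exp 1"
proof -
  have s: "subdegree (fps_exp 1 - 1 :: real fps) = 1"
    by (rule subdegreeI) auto
  have "subdegree (fps_exp 1 :: real fps) = 0"
    by (rule subdegreeI) auto
  then have t: "subdegree (fps_X * fps_exp 1 :: real fps) = 1"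
    by simp
  have "Abs_fps (\<lambda>j. bernoulli j / fact j) = fps_X * fps_exp 1 / (fps_exp 1 - 1)"
    by (rule fps_ext) (simp add: bernoulli_def)
  moreover have "(fps_exp 1 - 1 :: real fps) dvd fps_X * fps_exp 1"
    using s t by (subst fps_dvd_iff) auto
  ultimately show ?thesis
    by simp
qed

(* C_sum p [a_2, ..., a_r] x renders C^{(p)}_{a_2,...,a_r}(x), with a_1 = 0 prepended.
   Lists are indexed from 0, so a_i is a ! (i - 1), and j_1 + ... + j_{i-1} is
   sum_list (take (i - 1) js).  The condition sum_list js + last a \<le> p is the side condition
   j_1 + ... + j_r \<le> p - a_r stated without truncated subtraction; under it the exponent of x
   is not truncated.  The top argument of the binomial is formed in real, so it is not truncated
   either; where it is a natural number, gchoose is the ordinary binomial coefficient. *)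
definition C_sum :: "nat \<Rightarrow> nat list \<Rightarrow> real \<Rightarrow> real" where
  "C_sum p as x =
    (let a = 0 # as; r = length a
     in \<Sum>js\<in>{js. length js = r \<and> sum_list js + last a \<le> p}.
          (\<Prod>i<r. let N = real p + 1 - real (a ! i) - real (sum_list (take i js))
                  in (N gchoose (js ! i)) * bernoulli (js ! i) / N)
          * x ^ (p + 1 - last a - sum_list js))"

lemma C_sum_Nil:
  "C_sum p [] x =
    (\<Sum>j\<le>p. real ((p + 1) choose j) * bernoulli j / real (p + 1) * x ^ (p + 1 - j))"
proof -
  have "{js. length js = Suc 0 \<and> sum_list js \<le> p} = (\<lambda>j. [j]) ` {..p}"
    by (auto simp: length_Suc_conv)
  moreover have "inj_on (\<lambda>j. [j]) {..p}"
    by (auto intro: inj_onI)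
  ultimately show ?thesis
    by (simp add: C_sum_def Let_def sum.reindex binomial_gbinomial add.commute)
qed

(* The index set is finite; otherwise the sum would silently be 0. *)
lemma finite_C_sum_index:
  "finite {js :: nat list. length js = r \<and> sum_list js + b \<le> p}"
proof (rule finite_subset)
  show "{js :: nat list. length js = r \<and> sum_list js + b \<le> p}
      \<subseteq> {js. set js \<subseteq> {..p} \<and> length js = r}"
    using member_le_sum_list by fastforce
qed (simp add: finite_lists_length_eq)

end

theory Submission
  imports Defs
begin

text \<open>Summation by parts against \<open>C\<^sup>(\<^sup>p\<^sup>)\<close>, whose backward difference is \<open>x\<^sup>p\<close>, turns the sum into
  sums of \<open>C\<^sup>(\<^sup>p\<^sup>)(m) / m\<close> against \<open>H\<close> and of \<open>C\<^sup>(\<^sup>p\<^sup>)(m) / m\<^sup>2\<close>. Both quotients are again combinations of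
  powers of \<open>m\<close>, except for the term \<open>B\<^sub>p / m\<close> of the second, which sums to \<open>B\<^sub>p H\<^sub>n\<close>. Summing the powers
  prepends an index to the nested sums \<open>C\<close>, and a second summation by parts finishes the proof.\<close>

text \<open>The coefficient of x^(p+1-j) in C^(p)(x). With \<open>gchoose\<close> on a real top
  argument it is literally the first factor of the product in \<open>C_sum\<close>.\<close>

definition faulhaber_coeff :: "nat \<Rightarrow> nat \<Rightarrow> real" where
  "faulhaber_coeff p j = (real (p + 1) gchoose j) * bernoulli j / real (p + 1)"

lemma faulhaber_coeff_self: "faulhaber_coeff p p = bernoulli p"
proof -
  have "(real (p + 1) gchoose p) = real (p + 1)"
    by (metis binomial_gbinomial Suc_eq_plus1 binomial_Suc_n)
  then show ?thesis
    by (simp add: faulhaber_coeff_def)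
qed

lemma C_sum_Nil_faulhaber_coeff: "C_sum p [] x = (\<Sum>j\<le>p. faulhaber_coeff p j * x ^ (p + 1 - j))"
  by (simp add: C_sum_Nil faulhaber_coeff_def binomial_gbinomial)

text \<open>Multiplying \<open>bernoulli_egf\<close> by exp((x-1)X) gives B(X) (exp(xX) -
  exp((x-1)X)) = X exp(xX); the claim compares coefficients of X^(p+1).\<close>

lemma C_sum_Nil_diff: "C_sum p [] x - C_sum p [] (x - 1) = x ^ p"
proof -
  let ?B = "Abs_fps (\<lambda>j. bernoulli j / fact j)"
  have "?B * (fps_exp x - fps_exp (x - 1)) = ?B * (fps_exp 1 - 1) * fps_exp (x - 1)"
    using fps_exp_add_mult[of 1 "x - 1"] by (simp add: algebra_simps)
  also have "\<dots> = fps_X * fps_exp x"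
    using fps_exp_add_mult[of 1 "x - 1"] by (simp add: bernoulli_egf mult.assoc)
  finally have "fps_nth (?B * (fps_exp x - fps_exp (x - 1))) (Suc p) = x ^ p / fact p"
    by simp
  \<comment> \<open>The convolution runs up to p+1, but its last term vanishes because both
    exponentials have constant term 1.\<close>
  then have "(\<Sum>j\<le>p. bernoulli j / fact j *
      ((x ^ (p + 1 - j) - (x - 1) ^ (p + 1 - j)) / fact (p + 1 - j))) = x ^ p / fact p"
    by (simp add: fps_mult_nth atLeast0AtMost diff_divide_distrib)
  then have "x ^ p = fact p * (\<Sum>j\<le>p. bernoulli j / fact j *
      ((x ^ (p + 1 - j) - (x - 1) ^ (p + 1 - j)) / fact (p + 1 - j)))"
    by simp
  also have "\<dots> = (\<Sum>j\<le>p. faulhaber_coeff p j * (x ^ (p + 1 - j) - (x - 1) ^ (p + 1 - j)))"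
    unfolding sum_distrib_left
  proof (rule sum.cong[OF refl])
    fix j assume "j \<in> {..p}"
    then have "real (p + 1) gchoose j = fact (p + 1) / (fact j * fact (p + 1 - j))"
      by (metis atMost_iff binomial_fact binomial_gbinomial trans_le_add1)
    then have "faulhaber_coeff p j = fact p * bernoulli j / (fact j * fact (p + 1 - j))"
      by (simp add: faulhaber_coeff_def)
    then show "fact p * (bernoulli j / fact j *
        ((x ^ (p + 1 - j) - (x - 1) ^ (p + 1 - j)) / fact (p + 1 - j))) =
        faulhaber_coeff p j * (x ^ (p + 1 - j) - (x - 1) ^ (p + 1 - j))"
      by simp
  qed
  finally show ?thesis
    by (simp add: C_sum_Nil_faulhaber_coeff sum_subtractf right_diff_distrib)
qed

lemma C_sum_Nil_0: "C_sum p [] 0 = 0"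
  unfolding C_sum_Nil_faulhaber_coeff by (rule sum.neutral) (auto simp: zero_power)

lemma sum_power_eq_C_sum: "(\<Sum>m=1..n. real m ^ p) = C_sum p [] (real n)"
proof (induction n)
  case (Suc n)
  then show ?case
    using C_sum_Nil_diff[of p "real (Suc n)"] by simp
qed (simp add: C_sum_Nil_0)

text \<open>Fixing the first index j leaves the nested sum of order p-b-j: the shift by b and the
  index j are absorbed into its order. The entry 0 under \<open>map\<close> is the implicit a_1 of
  the inner sum. Only b = 0 and b = 1 are needed later.\<close>

lemma C_sum_shift:
  "C_sum p (map ((+) b) (0 # as)) x =
    (\<Sum>j | j + b \<le> p. faulhaber_coeff p j * C_sum (p - b - j) as x)"
proof -
  define a where "a = 0 # as"
  define r where "r = length a"
  define l where "l = last a"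
  let ?K = "\<lambda>j. {ks. length ks = r \<and> sum_list ks + l \<le> p - b - j}"
  let ?J = "{js. length js = Suc r \<and> sum_list js + (b + l) \<le> p}"
  let ?f = "\<lambda>q c js i. let N = real q + 1 - real (c ! i) - real (sum_list (take i js))
    in (N gchoose (js ! i)) * bernoulli (js ! i) / N"
  have "a \<noteq> []"
    by (simp add: a_def)
  have bij: "bij_betw (\<lambda>(j, ks). j # ks) (SIGMA j:{j. j + b \<le> p}. ?K j) ?J"
    by (rule bij_betwI[where g = "\<lambda>js. (hd js, tl js)"]) (auto simp: length_Suc_conv)
  have summand: "(\<Prod>i<Suc r. ?f p (0 # map ((+) b) a) (j # ks) i)
        * x ^ (p + 1 - (b + l) - sum_list (j # ks)) =
      faulhaber_coeff p j * ((\<Prod>i<r. ?f (p - b - j) a ks i) * x ^ (p - b - j + 1 - l - sum_list ks))"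
    if "j + b \<le> p" "ks \<in> ?K j" for j ks
  proof -
    have "?f p (0 # map ((+) b) a) (j # ks) (Suc i) = ?f (p - b - j) a ks i" if "i < r" for i
    proof -
      \<comment> \<open>Since \<open>j + b \<le> p\<close>, the natural number
        \<open>p - b - j\<close> is not truncated and may be expanded in the reals.\<close>
      have "real p + 1 - real ((0 # map ((+) b) a) ! Suc i) - real (sum_list (take (Suc i) (j # ks))) =
          real (p - b - j) + 1 - real (a ! i) - real (sum_list (take i ks))"
        using \<open>i < r\<close> \<open>j + b \<le> p\<close> by (simp add: r_def of_nat_diff)
      then show ?thesis
        by (simp only: nth_Cons_Suc Let_def)
    qed
    then have "(\<Prod>i<Suc r. ?f p (0 # map ((+) b) a) (j # ks) i) =
        faulhaber_coeff p j * (\<Prod>i<r. ?f (p - b - j) a ks i)"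
      unfolding prod.lessThan_Suc_shift by (simp add: faulhaber_coeff_def Let_def add.commute)
    moreover have "p + 1 - (b + l) - sum_list (j # ks) = p - b - j + 1 - l - sum_list ks"
      using that by auto
    ultimately show ?thesis
      by (simp only: mult.assoc)
  qed
  have "C_sum p (map ((+) b) a) x = (\<Sum>js\<in>?J. (\<Prod>i<Suc r. ?f p (0 # map ((+) b) a) js i)
      * x ^ (p + 1 - (b + l) - sum_list js))"
    using \<open>a \<noteq> []\<close> by (simp only: C_sum_def Let_def r_def l_def last_map last.simps map_is_Nil_conv
      length_Cons length_map if_False not_False_eq_True)
  also have "\<dots> = (\<Sum>(j, ks)\<in>(SIGMA j:{j. j + b \<le> p}. ?K j).
      faulhaber_coeff p j * ((\<Prod>i<r. ?f (p - b - j) a ks i) * x ^ (p - b - j + 1 - l - sum_list ks)))"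
    by (subst sum.reindex_bij_betw[OF bij, symmetric], rule sum.cong[OF refl])
      (use summand in \<open>auto simp only: mem_Sigma_iff split_conv mem_Collect_eq\<close>)
  also have "\<dots> = (\<Sum>j | j + b \<le> p. \<Sum>ks\<in>?K j.
      faulhaber_coeff p j * ((\<Prod>i<r. ?f (p - b - j) a ks i) * x ^ (p - b - j + 1 - l - sum_list ks)))"
    by (rule sum.Sigma[symmetric]) (auto intro: finite_subset[of _ "{..p}"] finite_C_sum_index)
  also have "\<dots> = (\<Sum>j | j + b \<le> p. faulhaber_coeff p j * C_sum (p - b - j) as x)"
    by (simp only: C_sum_def Let_def a_def[symmetric] r_def[symmetric] l_def[symmetric]
      sum_distrib_left[symmetric])
  finally show ?thesis
    by (simp only: a_def)
qed

lemma C_sum_Cons_0: "C_sum p (0 # as) x = (\<Sum>j\<le>p. faulhaber_coeff p j * C_sum (p - j) as x)"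
proof -
  have "map ((+) 0) (0 # as) = 0 # as"
    by (simp add: map_idI)
  then show ?thesis
    using C_sum_shift[of p 0 as x] by (simp add: atMost_def)
qed

lemma C_sum_1: "C_sum p [1] x = (\<Sum>j<p. faulhaber_coeff p j * C_sum (p - 1 - j) [] x)"
  using C_sum_shift[of p 1 "[]" x] by (simp add: lessThan_def Suc_le_eq)

lemma C_sum_Nil_div:
  assumes "x \<noteq> 0"
  shows "C_sum p [] x / x = (\<Sum>j\<le>p. faulhaber_coeff p j * x ^ (p - j))"
  unfolding C_sum_Nil_faulhaber_coeff sum_divide_distrib
  by (rule sum.cong) (use assms in \<open>auto simp: Suc_diff_le\<close>)

text \<open>The lowest term of C^(p)(x) is B_p x, from j = p; it alone leaves a negative power of x.
  This is the origin of B_p in the theorem.\<close>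

lemma C_sum_Nil_div_square:
  assumes "x \<noteq> 0"
  shows "C_sum p [] x / x\<^sup>2 = (\<Sum>j<p. faulhaber_coeff p j * x ^ (p - 1 - j)) + bernoulli p / x"
proof -
  have "C_sum p [] x / x\<^sup>2 = (\<Sum>j\<le>p. faulhaber_coeff p j * x ^ (p - j)) / x"
    by (simp add: C_sum_Nil_div[OF assms, symmetric] power2_eq_square)
  also have "\<dots> = (\<Sum>j<p. faulhaber_coeff p j * x ^ (p - j) / x) + bernoulli p / x"
    by (simp add: lessThan_Suc_atMost[symmetric] faulhaber_coeff_self add_divide_distrib
      sum_divide_distrib)
  also have "(\<Sum>j<p. faulhaber_coeff p j * x ^ (p - j) / x) =
      (\<Sum>j<p. faulhaber_coeff p j * x ^ (p - 1 - j))"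
  proof (rule sum.cong[OF refl])
    fix j assume "j \<in> {..<p}"
    then have "p - j = Suc (p - 1 - j)"
      by auto
    then show "faulhaber_coeff p j * x ^ (p - j) / x = faulhaber_coeff p j * x ^ (p - 1 - j)"
      using assms by (simp only: power_Suc) simp
  qed
  finally show ?thesis .
qed

text \<open>Summing each power m^(p-j) gives C^(p-j)(n), and \<open>C_sum_Cons_0\<close> reads the
  result as a prepended 0.\<close>

lemma sum_C_sum_Nil_div: "(\<Sum>m=1..n. C_sum p [] (real m) / real m) = C_sum p [0] (real n)"
proof -
  have "(\<Sum>m=1..n. C_sum p [] (real m) / real m) =
      (\<Sum>m=1..n. \<Sum>j\<le>p. faulhaber_coeff p j * real m ^ (p - j))"
    by (rule sum.cong) (auto simp: C_sum_Nil_div)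
  also have "\<dots> = (\<Sum>j\<le>p. faulhaber_coeff p j * (\<Sum>m=1..n. real m ^ (p - j)))"
    unfolding sum_distrib_left by (rule sum.swap)
  finally show ?thesis
    by (simp only: sum_power_eq_C_sum C_sum_Cons_0)
qed

lemma sum_C_sum_Nil_div_square:
  "(\<Sum>m=1..n. C_sum p [] (real m) / (real m)\<^sup>2) = C_sum p [1] (real n) + bernoulli p * harm n"
proof -
  have "(\<Sum>m=1..n. C_sum p [] (real m) / (real m)\<^sup>2) =
      (\<Sum>m=1..n. (\<Sum>j<p. faulhaber_coeff p j * real m ^ (p - 1 - j)) + bernoulli p / real m)"
    by (rule sum.cong[OF refl], rule C_sum_Nil_div_square) simp
  also have "\<dots> = (\<Sum>j<p. faulhaber_coeff p j * (\<Sum>m=1..n. real m ^ (p - 1 - j))) +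
      bernoulli p * harm n"
    unfolding sum.distrib sum_distrib_left harm_def
    by (subst sum.swap) (simp add: divide_inverse)
  finally show ?thesis
    by (simp only: sum_power_eq_C_sum C_sum_1)
qed

text \<open>The sum telescopes, with u taken at m-1 and F at m; F 0 = 0 removes the lower boundary
  term.\<close>

lemma sum_by_parts:
  fixes F u :: "nat \<Rightarrow> 'a :: comm_ring_1"
  assumes "F 0 = 0"
  shows "(\<Sum>m=1..n. (F m - F (m - 1)) * u (m - 1)) = F n * u n - (\<Sum>m=1..n. F m * (u m - u (m - 1)))"
  by (induction n) (auto simp: assms algebra_simps)

lemma sum_power_mult_by_parts:
  "(\<Sum>m=1..n. real m ^ p * u (m - 1)) =
    C_sum p [] (real n) * u n - (\<Sum>m=1..n. C_sum p [] (real m) * (u m - u (m - 1)))"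
proof -
  have "(\<Sum>m=1..n. real m ^ p * u (m - 1)) =
      (\<Sum>m=1..n. (C_sum p [] (real m) - C_sum p [] (real (m - 1))) * u (m - 1))"
    by (rule sum.cong[OF refl]) (simp add: of_nat_diff C_sum_Nil_diff)
  then show ?thesis
    by (simp only: sum_by_parts[where F = "\<lambda>m. C_sum p [] (real m)"] C_sum_Nil_0 of_nat_0)
qed

lemma harm_diff: "m \<ge> 1 \<Longrightarrow> harm m - harm (m - 1) = (1 / real m :: real)"
  by (cases m) (auto simp: harm_Suc divide_inverse)

lemma sum_power_mult_harm:
  "(\<Sum>m=1..n. real m ^ p * harm (m - 1)) = C_sum p [] (real n) * harm n - C_sum p [0] (real n)"
proof -
  have "(\<Sum>m=1..n. C_sum p [] (real m) * (harm m - harm (m - 1))) = C_sum p [0] (real n)"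
    unfolding sum_C_sum_Nil_div[symmetric] by (rule sum.cong[OF refl]) (simp only: atLeastAtMost_iff harm_diff, simp)
  then show ?thesis
    by (simp only: sum_power_mult_by_parts)
qed

text \<open>After expansion into powers, \<open>sum_power_mult_harm\<close> applies at each order
  p-j, and \<open>C_sum_Cons_0\<close> prepends a 0 to both of its nested sums.\<close>

lemma sum_C_sum_Nil_div_mult_harm:
  "(\<Sum>m=1..n. C_sum p [] (real m) / real m * harm (m - 1)) =
    C_sum p [0] (real n) * harm n - C_sum p [0, 0] (real n)"
proof -
  have "(\<Sum>m=1..n. C_sum p [] (real m) / real m * harm (m - 1)) =
      (\<Sum>m=1..n. \<Sum>j\<le>p. faulhaber_coeff p j * (real m ^ (p - j) * harm (m - 1)))"
    by (rule sum.cong) (auto simp: C_sum_Nil_div sum_distrib_right mult.assoc)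
  also have "\<dots> = (\<Sum>j\<le>p. faulhaber_coeff p j * (\<Sum>m=1..n. real m ^ (p - j) * harm (m - 1)))"
    unfolding sum_distrib_left by (rule sum.swap)
  finally show ?thesis
    unfolding sum_power_mult_harm C_sum_Cons_0
    by (simp add: right_diff_distrib sum_subtractf sum_distrib_right mult.assoc)
qed

theorem theorem2p5:
  fixes p n :: nat
  assumes "n \<ge> 1"
  shows "(\<Sum>m=1..n. real m ^ p * (harm (m - 1))\<^sup>2) =
    C_sum p [] (real n) * (harm n)\<^sup>2
    - (2 * C_sum p [0] (real n) + bernoulli p) * harm n
    + 2 * C_sum p [0, 0] (real n) - C_sum p [1] (real n)"
proof -
  \<comment> \<open>The increment of the squares, 2 H_(m-1)/m + 1/m^2, is expressed through H_(m-1)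
    rather than H_m to fit \<open>sum_C_sum_Nil_div_mult_harm\<close>.\<close>
  have "C_sum p [] (real m) * ((harm m)\<^sup>2 - (harm (m - 1))\<^sup>2) =
      2 * (C_sum p [] (real m) / real m * harm (m - 1)) + C_sum p [] (real m) / (real m)\<^sup>2"
    if "m \<in> {1..n}" for m
  proof -
    have h: "harm m = harm (m - 1) + 1 / real m"
      using harm_diff[of m] that by simp
    show ?thesis
      unfolding h by (simp add: power2_eq_square algebra_simps add_divide_distrib)
  qed
  then have "(\<Sum>m=1..n. C_sum p [] (real m) * ((harm m)\<^sup>2 - (harm (m - 1))\<^sup>2)) =
      2 * (\<Sum>m=1..n. C_sum p [] (real m) / real m * harm (m - 1)) +
      (\<Sum>m=1..n. C_sum p [] (real m) / (real m)\<^sup>2)"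
    by (simp add: sum.distrib sum_distrib_left)
  then show ?thesis
    unfolding sum_power_mult_by_parts[where u = "\<lambda>m. (harm m)\<^sup>2"]
      sum_C_sum_Nil_div_mult_harm sum_C_sum_Nil_div_square
    by (simp add: algebra_simps)
qed

end
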